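(* Let $\mathcal{M}=(Q,\Sigma,\cdot,\circ)$ be a reversible invertible Mealy automaton such that, for all $\xi\in\Sigma^\omega$, the set $\mathrm{Stab}^{+}(\xi)$ contains only torsion elements. Then $\langle\mathcal{M}\rangle$ is fully positive.
   Context: A Mealy automaton is $\mathcal{M}=(Q,\Sigma,\cdot,\circ)$ with finite nonempty sets $Q$ (states) and $\Sigma$ (alphabet), a transition function $(q,a)\mapsto q\cdot a\in Q$ and a production function $(q,a)\mapsto q\circ a\in\Sigma$. Extend by $q\circ(a_1\cdots a_n)=(q\circ a_1)\big((q\cdot a_1)\circ(a_2\cdots a_n)\big)$. It is invertible if each map $a\mapsto q\circ a$ is a permutation of $\Sigma$, and reversible if each map $q\mapsto q\cdot a$ is a permutation of $Q$. For an invertible automaton each $q$ acts as an automorphism of the rooted tree $\Sigma^*$; $\langle\mathcal{M}\rangle$ is the group generated by these automorphisms, acting on the boundary $\Sigma^\omega$ of right-infinite words. $\mathrm{Stab}^+(\xi)$ is the set of elements $g\in\langle\mathcal{M}\rangle$ with $g\circ\xi=\xi$ that are products of (possibly zero) states in $Q$, without inverses. A group $G$ with generating set $X$ is fully positive if it has a presentation $\langle X\mid R\rangle$ with $R\subseteq X^*$ (the relators contain no inverses of generators) and such that for every $x\in X$ there is a word in $R$ having $x$ as a prefix. For $\langle\mathcal{M}\rangle$ the generating set is $Q$. *)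

theory Defs
  imports "HOL-Algebra.Algebra" "HOL-Library.Omega_Words_Fun"
begin

section \<open>Mealy automata\<close>

text \<open>The state set and the alphabet are the universes of two types, which the main statement
  requires to be finite; they are automatically nonempty.\<close>

record ('q, 'a) mealy =
  trans_fun :: "'q \<Rightarrow> 'a \<Rightarrow> 'q"
  prod_fun :: "'q \<Rightarrow> 'a \<Rightarrow> 'a"

definition invertible_mealy :: "('q, 'a) mealy \<Rightarrow> bool" where
  "invertible_mealy M \<longleftrightarrow> (\<forall>q. bij (\<lambda>a. prod_fun M q a))"

definition reversible_mealy :: "('q, 'a) mealy \<Rightarrow> bool" where
  "reversible_mealy M \<longleftrightarrow> (\<forall>a. bij (\<lambda>q. trans_fun M q a))"

fun act :: "('q, 'a) mealy \<Rightarrow> 'q \<Rightarrow> 'a list \<Rightarrow> 'a list" where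
  "act M q [] = []"
| "act M q (a # w) = prod_fun M q a # act M (trans_fun M q a) w"

text \<open>For an invertible automaton all maps \<open>act M q\<close> are bijections, so that
  intersecting with the carrier inside \<open>subgroup_generated\<close> loses nothing.\<close>

definition mealy_group :: "('q, 'a) mealy \<Rightarrow> ('a list \<Rightarrow> 'a list) monoid" where
  "mealy_group M = subgroup_generated (BijGroup UNIV) (range (act M))"

text \<open>The product of a (possibly empty) word of states; the rightmost state acts first.\<close>

definition state_product :: "('q, 'a) mealy \<Rightarrow> 'q list \<Rightarrow> ('a list \<Rightarrow> 'a list)" where
  "state_product M qs = foldr (\<lambda>q g. act M q \<otimes>\<^bsub>mealy_group M\<^esub> g) qs \<one>\<^bsub>mealy_group M\<^esub>"

text \<open>The extension of a tree automorphism to the boundary of the tree. It is meaningful for maps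
  that preserve lengths and prefixes, see \<open>mealy_group_boundary\<close> below.\<close>

definition boundary_act :: "('a list \<Rightarrow> 'a list) \<Rightarrow> 'a word \<Rightarrow> 'a word" where
  "boundary_act g \<xi> = (\<lambda>n. g (prefix (Suc n) \<xi>) ! n)"

definition pos_stab :: "('q, 'a) mealy \<Rightarrow> 'a word \<Rightarrow> ('a list \<Rightarrow> 'a list) set" where
  "pos_stab M \<xi> = {g \<in> carrier (mealy_group M).
     boundary_act g \<xi> = \<xi> \<and> (\<exists>qs. g = state_product M qs)}"

definition torsion_element :: "('g, 'm) monoid_scheme \<Rightarrow> 'g \<Rightarrow> bool" where
  "torsion_element G g \<longleftrightarrow> g \<in> carrier G \<and> (\<exists>n::nat. n > 0 \<and> g [^]\<^bsub>G\<^esub> n = \<one>\<^bsub>G\<^esub>)"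


section \<open>Group presentations\<close>

text \<open>Elements of the free group are classes of words over signed letters: \<open>(x, True)\<close> stands for
  the generator \<open>x\<close> and \<open>(x, False)\<close> for its inverse.\<close>

inductive cancel_step :: "('x \<times> bool) list \<Rightarrow> ('x \<times> bool) list \<Rightarrow> bool" where
  "cancel_step (u @ [(x, b), (x, \<not> b)] @ v) (u @ v)"

definition free_class :: "('x \<times> bool) list \<Rightarrow> ('x \<times> bool) list set" where
  "free_class w = {v. equivclp cancel_step w v}"

definition free_grp :: "('x \<times> bool) list set monoid" where
  "free_grp = \<lparr>carrier = range free_class,
     monoid.mult = (\<lambda>A B. \<Union>u\<in>A. \<Union>v\<in>B. free_class (u @ v)),
     one = free_class []\<rparr>"

definition pos_class :: "'x list \<Rightarrow> ('x \<times> bool) list set" where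
  "pos_class w = free_class (map (\<lambda>x. (x, True)) w)"

definition normal_closure :: "('g, 'm) monoid_scheme \<Rightarrow> 'g set \<Rightarrow> 'g set" where
  "normal_closure G S = \<Inter>{N. N \<lhd> G \<and> S \<subseteq> N}"

text \<open>\<open>has_pos_presentation G \<iota> R\<close>: the group \<open>G\<close>, generated by the family \<open>\<iota>\<close>, has the presentation
  \<open>\<langle>X | R\<rangle>\<close>, where \<open>X\<close> is the index type of the family and all relators are positive words. The
  quotient of the free group by the normal closure of \<open>R\<close> is isomorphic to \<open>G\<close> in such a way that the
  class of each \<open>x\<close> corresponds to \<open>\<iota> x\<close>.\<close>

definition has_pos_presentation ::
  "('g, 'm) monoid_scheme \<Rightarrow> ('x \<Rightarrow> 'g) \<Rightarrow> 'x list set \<Rightarrow> bool" where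
  "has_pos_presentation G \<iota> R \<longleftrightarrow>
     (let N = normal_closure free_grp (pos_class ` R) in
        \<exists>\<phi> \<in> iso (free_grp Mod N) G. \<forall>x. \<phi> (N #>\<^bsub>free_grp\<^esub> pos_class [x]) = \<iota> x)"

definition fully_positive :: "('g, 'm) monoid_scheme \<Rightarrow> ('x \<Rightarrow> 'g) \<Rightarrow> bool" where
  "fully_positive G \<iota> \<longleftrightarrow>
     (\<exists>R. has_pos_presentation G \<iota> R \<and> (\<forall>x. \<exists>w. x # w \<in> R))"


section \<open>Well-definedness\<close>

lemma cancel_step_append:
  "cancel_step u u' \<Longrightarrow> cancel_step (p @ u @ s) (p @ u' @ s)"
proof (induction rule: cancel_step.induct)
  case (1 u x b v)
  show ?case using cancel_step.intros[of "p @ u" x b "v @ s"] by simp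
qed

lemma equiv_append:
  assumes "equivclp cancel_step u u'"
  shows "equivclp cancel_step (p @ u @ s) (p @ u' @ s)"
  using assms
proof (induction rule: equivclp_induct)
  case base
  show ?case by simp
next
  case (step y z)
  then show ?case using cancel_step_append by (metis equivclp_into_equivclp)
qed

lemma equiv_append2:
  assumes "equivclp cancel_step u u'" "equivclp cancel_step v v'"
  shows "equivclp cancel_step (u @ v) (u' @ v')"
  using equiv_append[OF assms(1), of "[]" v] equiv_append[OF assms(2), of u' "[]"]
  by (auto intro: equivclp_trans)

lemma free_class_eq_iff: "free_class u = free_class v \<longleftrightarrow> equivclp cancel_step u v"
  unfolding free_class_def by (auto intro: equivclp_trans equivclp_sym)

lemma free_class_self: "u \<in> free_class u"
  by (simp add: free_class_def)

lemma free_grp_mult [simp]: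
  "free_class u \<otimes>\<^bsub>free_grp\<^esub> free_class v = free_class (u @ v)"
proof -
  have "free_class (u' @ v') = free_class (u @ v)"
    if "u' \<in> free_class u" "v' \<in> free_class v" for u' v'
    using that equiv_append2 by (metis free_class_eq_iff free_class_def mem_Collect_eq)
  then have "(\<Union>u'\<in>free_class u. \<Union>v'\<in>free_class v. free_class (u' @ v'))
      = (\<Union>u'\<in>free_class u. \<Union>v'\<in>free_class v. free_class (u @ v))"
    by simp
  also have "\<dots> = free_class (u @ v)"
    using free_class_self[of u] free_class_self[of v] by blast
  finally show ?thesis
    by (simp add: free_grp_def)
qed

lemma free_grp_carrier: "carrier free_grp = range free_class"
  and free_grp_one: "\<one>\<^bsub>free_grp\<^esub> = free_class []"
  by (simp_all add: free_grp_def)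

lemma free_class_inverse:
  "free_class (rev (map (\<lambda>(x, b). (x, \<not> b)) w) @ w) = free_class []"
proof (induction w)
  case Nil
  show ?case by simp
next
  case (Cons l w)
  obtain x b where l: "l = (x, b)" by force
  let ?r = "rev (map (\<lambda>(x, b). (x, \<not> b)) w)"
  have "cancel_step (?r @ [(x, \<not> b), (x, \<not> \<not> b)] @ w) (?r @ w)"
    by (rule cancel_step.intros)
  then have "free_class (?r @ [(x, \<not> b), (x, b)] @ w) = free_class (?r @ w)"
    by (auto simp: free_class_eq_iff)
  then show ?case using Cons l by simp
qed

lemma group_free_grp: "group free_grp"
proof (rule groupI)
  fix A :: "('x \<times> bool) list set"
  assume "A \<in> carrier free_grp"
  then obtain w where A: "A = free_class w" by (auto simp: free_grp_carrier)
  show "\<exists>B\<in>carrier free_grp. B \<otimes>\<^bsub>free_grp\<^esub> A = \<one>\<^bsub>free_grp\<^esub>"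
    unfolding A free_grp_carrier free_grp_one
    using free_class_inverse[of w] by (metis free_grp_mult rangeI)
qed (auto simp: free_grp_carrier free_grp_one)

lemma normal_closure_normal:
  assumes "group G" "S \<subseteq> carrier G"
  shows "normal_closure G S \<lhd> G"
proof -
  interpret group G by fact
  have G: "carrier G \<in> {N. N \<lhd> G \<and> S \<subseteq> N}"
    using assms(2) by (auto simp: normal_inv_iff subgroup_self)
  have "subgroup (normal_closure G S) G"
    unfolding normal_closure_def
    using G by (intro subgroups_Inter) (auto simp: normal_imp_subgroup)
  then show ?thesis
    unfolding normal_inv_iff normal_closure_def
    by (auto intro: normal.inv_op_closed2)
qed

lemma group_mealy_group: "group (mealy_group M)"
  unfolding mealy_group_def
  by (simp add: group.group_subgroup_generated group_BijGroup)

lemma act_append: "\<exists>q'. act M q (u @ v) = act M q u @ act M q' v"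
  by (induction u arbitrary: q) auto

lemma length_act [simp]: "length (act M q w) = length w"
  by (induction w arbitrary: q) auto

lemma inj_act:
  assumes "invertible_mealy M"
  shows "act M q u = act M q v \<Longrightarrow> u = v"
proof (induction u arbitrary: q v)
  case Nil
  then show ?case by (cases v) auto
next
  case (Cons a u)
  then obtain b v' where v: "v = b # v'" by (cases v) auto
  have "a = b" using Cons.prems assms v
    by (auto simp: invertible_mealy_def bij_def dest: injD)
  then show ?case using Cons v by auto
qed

lemma surj_act:
  assumes "invertible_mealy M"
  shows "\<exists>u. act M q u = v"
proof (induction v arbitrary: q)
  case Nil
  have "act M q [] = []" by simp
  then show ?case by blast
next
  case (Cons b v)
  obtain a where a: "prod_fun M q a = b"
    using assms unfolding invertible_mealy_def by (metis bij_pointE)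
  obtain u where "act M (trans_fun M q a) u = v" using Cons by blast
  then have "act M q (a # u) = b # v" using a by simp
  then show ?case by blast
qed

lemma act_in_Bij:
  assumes "invertible_mealy M"
  shows "act M q \<in> carrier (BijGroup UNIV)"
proof -
  have "bij (act M q)"
    using inj_act[OF assms] surj_act[OF assms] unfolding bij_def inj_def surj_def by metis
  then show ?thesis by (simp add: BijGroup_def Bij_def)
qed

lemma act_in_mealy_group:
  assumes "invertible_mealy M"
  shows "act M q \<in> carrier (mealy_group M)"
  using act_in_Bij[OF assms]
  unfolding mealy_group_def carrier_subgroup_generated
  by (intro generate.incl) auto

lemma BijGroup_UNIV_mult:
  "f \<in> carrier (BijGroup UNIV) \<Longrightarrow> g \<in> carrier (BijGroup UNIV) \<Longrightarrow>
     f \<otimes>\<^bsub>BijGroup UNIV\<^esub> g = f \<circ> g"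
  by (auto simp: BijGroup_def compose_def fun_eq_iff)

definition tree_endo :: "('a list \<Rightarrow> 'a list) \<Rightarrow> bool" where
  "tree_endo g \<longleftrightarrow> (\<forall>w. length (g w) = length w) \<and> (\<forall>u v. take (length u) (g (u @ v)) = g u)"

lemma tree_endo_act: "tree_endo (act M q)"
proof -
  have "take (length u) (act M q (u @ v)) = act M q u" for u v
    using act_append[of M q u v] by auto
  then show ?thesis by (simp add: tree_endo_def)
qed

lemma tree_endo_comp:
  assumes "tree_endo f" "tree_endo g"
  shows "tree_endo (f \<circ> g)"
proof -
  have "take (length u) (f (g (u @ v))) = f (g u)" for u v
  proof -
    have "g (u @ v) = g u @ drop (length u) (g (u @ v))"
      using assms(2) unfolding tree_endo_def by (metis append_take_drop_id)
    then show ?thesis using assms unfolding tree_endo_def by metis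
  qed
  then show ?thesis using assms by (simp add: tree_endo_def)
qed

lemma tree_endo_inverse:
  assumes "tree_endo f" "\<And>w. f (g w) = w" "\<And>w. g (f w) = w"
  shows "tree_endo g"
proof -
  have len: "length (g w) = length w" for w
    using assms unfolding tree_endo_def by metis
  have "take (length u) (g (u @ v)) = g u" for u v
  proof -
    let ?p = "take (length u) (g (u @ v))"
    have "length ?p = length u" using len by simp
    moreover have "g (u @ v) = ?p @ drop (length u) (g (u @ v))" by simp
    ultimately have "take (length u) (f (g (u @ v))) = f ?p"
      using assms(1) unfolding tree_endo_def by metis
    then have "f ?p = u" using assms(2) by simp
    then show ?thesis using assms(3) by metis
  qed
  then show ?thesis using len by (simp add: tree_endo_def)
qed

lemma mealy_group_tree_endo:
  assumes "g \<in> carrier (mealy_group M)"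
  shows "tree_endo g"
proof -
  interpret B: group "BijGroup (UNIV :: 'a list set)" by (rule group_BijGroup)
  let ?S = "carrier (BijGroup UNIV) \<inter> range (act M)"
  have "g \<in> generate (BijGroup UNIV) ?S"
    using assms by (simp add: mealy_group_def carrier_subgroup_generated)
  then show ?thesis
  proof (induction rule: generate.induct)
    case one
    show ?case by (simp add: BijGroup_def tree_endo_def)
  next
    case (incl h)
    then show ?case using tree_endo_act by auto
  next
    case (inv h)
    let ?h = "inv\<^bsub>BijGroup UNIV\<^esub> h"
    have h: "h \<in> carrier (BijGroup UNIV)" "?h \<in> carrier (BijGroup UNIV)"
      using inv by auto
    have "h \<circ> ?h = id" "?h \<circ> h = id"
      using h B.r_inv[OF h(1)] B.l_inv[OF h(1)]
      by (simp_all add: BijGroup_UNIV_mult) (auto simp: BijGroup_def)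
    then have "h (?h w) = w" "?h (h w) = w" for w
      by (simp_all add: fun_eq_iff)
    moreover have "tree_endo h" using inv tree_endo_act by auto
    ultimately show ?case by (rule tree_endo_inverse[rotated])
  next
    case (eng h1 h2)
    have "h1 \<in> carrier (BijGroup UNIV)" "h2 \<in> carrier (BijGroup UNIV)"
      using eng B.generate_in_carrier[of ?S] by auto
    then show ?case using tree_endo_comp[of h1 h2] eng by (simp add: BijGroup_UNIV_mult comp_def)
  qed
qed

lemma mealy_group_boundary:
  assumes "g \<in> carrier (mealy_group M)"
  shows "prefix n (boundary_act g \<xi>) = g (prefix n \<xi>)"
proof (rule nth_equalityI)
  have g: "tree_endo g" using mealy_group_tree_endo[OF assms] .
  show len: "length (prefix n (boundary_act g \<xi>)) = length (g (prefix n \<xi>))"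
    using g by (simp add: tree_endo_def)
  fix i assume "i < length (prefix n (boundary_act g \<xi>))"
  then have i: "i < n" by simp
  have "prefix n \<xi> = prefix (Suc i) \<xi> @ (\<xi> [Suc i \<rightarrow> n])"
    using subsequence_append[where i = "Suc i" and j = "n - Suc i" and w = \<xi>] i by simp
  then have "take (Suc i) (g (prefix n \<xi>)) = g (prefix (Suc i) \<xi>)"
    using g unfolding tree_endo_def by (metis diff_zero subsequence_length)
  then have "g (prefix n \<xi>) ! i = g (prefix (Suc i) \<xi>) ! i"
    by (metis lessI nth_take)
  then show "prefix n (boundary_act g \<xi>) ! i = g (prefix n \<xi>) ! i"
    using i by (simp add: boundary_act_def)
qed

end

theory Submission
  imports Defs
begin

text \<open>Full positivity amounts to every generator having a positive inverse. If the inverse of each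
  generator is represented by a positive word, then in the quotient of the free group by all positive
  words that are trivial in the group, every element is the class of a positive word. A positive word
  that is trivial in the group is one of the relators, so this quotient is the group itself
  (\<open>fully_positive_if_positive_inverses\<close>).

  A positive inverse of a state \<open>q\<close> comes from an infinite word that is fixed by a product of states
  whose leftmost factor is \<open>q\<close>: by hypothesis this product is torsion, and a trivial power of it is
  a positive relator beginning with \<open>q\<close>. To find the infinite word, regard a transition of the
  automaton as a square tile with the state \<open>q\<close> on its west side, the state \<open>q \<cdot> a\<close> on its east
  side, the letter \<open>a\<close> on its south side and \<open>q \<circ> a\<close> on its north side. A tile is determined by its
  west and north sides, since the automaton is invertible, and by its east and south sides, since it is
  reversible. Hence sending a tile to the one whose west and north sides are the east and south sides
  of the given one permutes the finite set of tiles, and each tile lies on a cycle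
  \<open>(q\<^sub>1, a\<^sub>1), \<dots>, (q\<^sub>k, a\<^sub>k)\<close>. Continuing the indices periodically, \<open>q\<^sub>j\<close> sends
  \<open>a\<^sub>j a\<^sub>j\<^sub>+\<^sub>1 \<dots>\<close> to \<open>a\<^sub>j\<^sub>-\<^sub>1 a\<^sub>j \<dots>\<close>. Therefore \<open>q\<^sub>1 \<cdots> q\<^sub>k\<close> shifts
  the periodic word \<open>a\<^sub>0 a\<^sub>1 \<dots>\<close> by a full period, that is, fixes it; and \<open>q\<^sub>1\<close> can be any state.\<close>

section \<open>Positive presentations from positive inverses\<close>

definition word_value :: "('g, 'm) monoid_scheme \<Rightarrow> ('x \<Rightarrow> 'g) \<Rightarrow> ('x \<times> bool) list \<Rightarrow> 'g" where
  "word_value G \<iota> w =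
     foldr (\<lambda>(x, b) g. (if b then \<iota> x else inv\<^bsub>G\<^esub> \<iota> x) \<otimes>\<^bsub>G\<^esub> g) w \<one>\<^bsub>G\<^esub>"

definition pos_value :: "('g, 'm) monoid_scheme \<Rightarrow> ('x \<Rightarrow> 'g) \<Rightarrow> 'x list \<Rightarrow> 'g" where
  "pos_value G \<iota> w = foldr (\<lambda>x g. \<iota> x \<otimes>\<^bsub>G\<^esub> g) w \<one>\<^bsub>G\<^esub>"

lemma word_value_positive: "word_value G \<iota> (map (\<lambda>x. (x, True)) w) = pos_value G \<iota> w"
  by (induction w) (simp_all add: word_value_def pos_value_def)

context group
begin

context
  fixes \<iota> :: "'x \<Rightarrow> 'a"
  assumes gens: "range \<iota> \<subseteq> carrier G"
begin

lemma word_value_closed: "word_value G \<iota> w \<in> carrier G"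
  using range_subsetD[OF gens] by (induction w) (auto simp: word_value_def)

lemma word_value_append: "word_value G \<iota> (u @ v) = word_value G \<iota> u \<otimes> word_value G \<iota> v"
proof (induction u)
  case Nil
  show ?case using word_value_closed[of v] by (simp add: word_value_def)
next
  case (Cons l u)
  obtain x b where l: "l = (x, b)" by force
  have "\<iota> x \<in> carrier G" using gens by blast
  then show ?case
    using Cons word_value_closed[of u] word_value_closed[of v]
    by (simp add: l word_value_def m_assoc)
qed

lemma pos_value_closed: "pos_value G \<iota> w \<in> carrier G"
  using word_value_closed by (simp flip: word_value_positive)

lemma pos_value_append: "pos_value G \<iota> (u @ v) = pos_value G \<iota> u \<otimes> pos_value G \<iota> v"
  using word_value_append by (simp flip: word_value_positive)

lemma pos_value_power: "pos_value G \<iota> (concat (replicate n w)) = pos_value G \<iota> w [^] n"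
proof (induction n)
  case 0
  show ?case by (simp add: pos_value_def)
next
  case (Suc n)
  then show ?case
    using nat_pow_Suc2[OF pos_value_closed, of w n] by (simp add: pos_value_append)
qed

lemma word_value_cancel_step:
  assumes "cancel_step u v"
  shows "word_value G \<iota> u = word_value G \<iota> v"
  using assms
proof cases
  case (1 p x b s)
  have x: "\<iota> x \<in> carrier G" using gens by blast
  have "word_value G \<iota> [(x, b), (x, \<not> b)] = \<one>"
    using x by (cases b) (simp_all add: word_value_def)
  then show ?thesis
    using word_value_closed by (simp only: 1 word_value_append) simp
qed

lemma word_value_free_class:
  assumes "u \<in> free_class w"
  shows "word_value G \<iota> u = word_value G \<iota> w"
proof -
  have "equivclp cancel_step w u" using assms by (simp add: free_class_def)
  then show ?thesis
    by (induction rule: equivclp_induct) (auto dest: word_value_cancel_step)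
qed

text \<open>The universal property of the free group. By invariance under cancellation it does not matter
  which representative of a class is evaluated.\<close>

definition class_value :: "('x \<times> bool) list set \<Rightarrow> 'a" where
  "class_value A = word_value G \<iota> (SOME w. w \<in> A)"

lemma class_value_free_class [simp]: "class_value (free_class w) = word_value G \<iota> w"
  unfolding class_value_def
  using free_class_self by (intro word_value_free_class) (rule someI)

lemma group_hom_class_value: "group_hom free_grp G class_value"
proof (intro group_hom.intro group_hom_axioms.intro homI)
  show "group free_grp" by (rule group_free_grp)
  show "group G" by (rule is_group)
qed (auto simp: free_grp_carrier word_value_closed word_value_append)

lemma class_value_onto:
  assumes "carrier G \<subseteq> generate G (range \<iota>)"
  shows "class_value ` carrier free_grp = carrier G"
proof
  interpret h: group_hom free_grp G class_value by (rule group_hom_class_value)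
  show "class_value ` carrier free_grp \<subseteq> carrier G" by auto
  have "range \<iota> \<subseteq> class_value ` carrier free_grp"
  proof
    fix g assume "g \<in> range \<iota>"
    then obtain x where x: "g = \<iota> x" "\<iota> x \<in> carrier G" using gens by auto
    then have "g = class_value (free_class [(x, True)])"
      by (simp add: word_value_def)
    then show "g \<in> class_value ` carrier free_grp"
      unfolding free_grp_carrier by blast
  qed
  then show "carrier G \<subseteq> class_value ` carrier free_grp"
    using assms generate_subgroup_incl h.img_is_subgroup by blast
qed

end

end

text \<open>A positive relator \<open>x v\<close> makes \<open>v\<close> an inverse of \<open>x\<close> in the quotient, so each inverse letter
  can be traded for a positive word.\<close>

lemma coset_contains_positive:
  assumes normal: "N \<lhd> free_grp"
    and relators: "\<And>x. \<exists>v. pos_class (x # v) \<in> N"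
  shows "\<exists>p. N #>\<^bsub>free_grp\<^esub> free_class w = N #>\<^bsub>free_grp\<^esub> pos_class p"
proof (induction w)
  case Nil
  have "free_class [] = pos_class []" by (simp add: pos_class_def)
  then show ?case by metis
next
  case (Cons l w)
  interpret N: normal N free_grp by fact
  let ?Q = "free_grp Mod N" and ?c = "\<lambda>A. N #>\<^bsub>free_grp\<^esub> A"
  interpret Q: group ?Q by (rule N.factorgroup_is_group)
  interpret c: group_hom free_grp ?Q ?c
    by unfold_locales (rule N.r_coset_hom_Mod)
  have in_F: "free_class u \<in> carrier free_grp" for u by (simp add: free_grp_carrier)
  have c_append: "?c (free_class (u @ v)) = ?c (free_class u) \<otimes>\<^bsub>?Q\<^esub> ?c (free_class v)" for u v
    using c.hom_mult[OF in_F in_F, of u v] by (simp only: free_grp_mult)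
  have letter: "\<exists>v. ?c (free_class [l]) = ?c (pos_class v)"
  proof (cases l)
    case (Pair x b)
    show ?thesis
    proof (cases b)
      case True
      then have "free_class [l] = pos_class [x]" using Pair by (simp add: pos_class_def)
      then show ?thesis by metis
    next
      case False
      obtain v where v: "pos_class (x # v) \<in> N" using relators by blast
      have "?c (pos_class (x # v)) = \<one>\<^bsub>?Q\<^esub>"
        using v by (simp add: N.rcos_const)
      then have 1: "?c (free_class [(x, True)]) \<otimes>\<^bsub>?Q\<^esub> ?c (pos_class v) = \<one>\<^bsub>?Q\<^esub>"
        using c_append[of "[(x, True)]" "map (\<lambda>x. (x, True)) v"] by (simp add: pos_class_def)
      have "cancel_step ([] @ [(x, False), (x, \<not> False)] @ []) ([] @ [])"
        by (rule cancel_step.intros)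
      then have "free_class ([l] @ [(x, True)]) = \<one>\<^bsub>free_grp\<^esub>"
        using Pair False by (auto simp: free_class_eq_iff free_grp_one)
      then have 2: "?c (free_class [l]) \<otimes>\<^bsub>?Q\<^esub> ?c (free_class [(x, True)]) = \<one>\<^bsub>?Q\<^esub>"
        using c_append[of "[l]" "[(x, True)]"] by (metis c.hom_one)
      have "?c (free_class [l]) = ?c (pos_class v)"
        by (rule Q.inv_unique[OF 2 1]) (auto simp only: pos_class_def intro!: c.hom_closed in_F)
      then show ?thesis by blast
    qed
  qed
  then obtain v where v: "?c (free_class [l]) = ?c (pos_class v)" by blast
  obtain p where p: "?c (free_class w) = ?c (pos_class p)" using Cons by blast
  have "?c (free_class (l # w)) = ?c (free_class [l]) \<otimes>\<^bsub>?Q\<^esub> ?c (free_class w)"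
    using c_append[of "[l]" w] by simp
  also have "\<dots> = ?c (pos_class v) \<otimes>\<^bsub>?Q\<^esub> ?c (pos_class p)"
    by (simp only: v p)
  also have "\<dots> = ?c (pos_class (v @ p))"
    using c_append[of "map (\<lambda>x. (x, True)) v" "map (\<lambda>x. (x, True)) p"]
    by (simp add: pos_class_def)
  finally show ?case by blast
qed

text \<open>The relators are all positive words with trivial value. Their normal closure \<open>N\<close> is the kernel
  of the evaluation map: a kernel element agrees modulo \<open>N\<close> with a positive word, whose value is then
  trivial too, so that it is itself a relator.\<close>

theorem fully_positive_if_positive_inverses:
  fixes G :: "('g, 'm) monoid_scheme" and \<iota> :: "'x \<Rightarrow> 'g"
  assumes "group G"
    and gens: "range \<iota> \<subseteq> carrier G"
    and generate: "carrier G \<subseteq> generate G (range \<iota>)"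
    and inverses: "\<And>x. \<exists>w. pos_value G \<iota> (x # w) = \<one>\<^bsub>G\<^esub>"
  shows "fully_positive G \<iota>"
proof -
  interpret group G by fact
  let ?h = "class_value \<iota>"
  interpret h: group_hom free_grp G ?h by (rule group_hom_class_value[OF gens])
  define R where "R = {w. pos_value G \<iota> w = \<one>\<^bsub>G\<^esub>}"
  define N where "N = normal_closure free_grp (pos_class ` R)"
  have h_pos: "?h (pos_class w) = pos_value G \<iota> w" for w
    by (simp add: pos_class_def class_value_free_class[OF gens] word_value_positive)
  have pos_in_F: "pos_class w \<in> carrier free_grp" for w :: "'x list"
    by (simp add: pos_class_def free_grp_carrier)
  have normal: "N \<lhd> free_grp"
    unfolding N_def using pos_in_F by (intro normal_closure_normal group_free_grp) auto
  interpret N: normal N free_grp by fact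
  have R_N: "pos_class w \<in> N" if "w \<in> R" for w
    using that unfolding N_def normal_closure_def by blast
  have N_kernel: "N \<subseteq> kernel free_grp G ?h"
  proof -
    have "pos_class ` R \<subseteq> kernel free_grp G ?h"
      using h_pos pos_in_F by (auto simp: kernel_def R_def)
    then show ?thesis
      using h.normal_kernel unfolding N_def normal_closure_def by blast
  qed
  have "kernel free_grp G ?h \<subseteq> N"
  proof
    fix A assume A: "A \<in> kernel free_grp G ?h"
    then have A_F: "A \<in> carrier free_grp" and A_one: "?h A = \<one>\<^bsub>G\<^esub>"
      by (auto simp: kernel_def)
    obtain w where w: "A = free_class w" using A_F by (auto simp: free_grp_carrier)
    have "\<exists>v. pos_class (x # v) \<in> N" for x
      using inverses[of x] R_N by (auto simp: R_def)
    then obtain p where p: "N #>\<^bsub>free_grp\<^esub> A = N #>\<^bsub>free_grp\<^esub> pos_class p"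
      using coset_contains_positive[OF normal, of w] unfolding w by auto
    have "A \<in> N #>\<^bsub>free_grp\<^esub> pos_class p"
      using group.rcos_self[OF group_free_grp A_F N.subgroup_axioms] p by simp
    then obtain m where m: "m \<in> N" "A = m \<otimes>\<^bsub>free_grp\<^esub> pos_class p"
      by (auto simp: r_coset_def)
    have "?h m = \<one>\<^bsub>G\<^esub>" "m \<in> carrier free_grp"
      using m N_kernel by (auto simp: kernel_def)
    then have "pos_value G \<iota> p = \<one>\<^bsub>G\<^esub>"
      using A_one m h.hom_mult[OF _ pos_in_F, of m p] h_pos pos_value_closed[OF gens, of p] by simp
    then show "A \<in> N" using m R_N by (simp add: R_def)
  qed
  then have N: "N = kernel free_grp G ?h" using N_kernel by blast
  have iso: "(\<lambda>C. the_elem (?h ` C)) \<in> iso (free_grp Mod N) G"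
    unfolding N by (rule h.FactGroup_iso_set[OF class_value_onto[OF gens generate]])
  have "the_elem (?h ` (N #>\<^bsub>free_grp\<^esub> pos_class [x])) = \<iota> x" for x
  proof -
    have x: "\<iota> x \<in> carrier G" using gens by blast
    have "?h (m \<otimes>\<^bsub>free_grp\<^esub> pos_class [x]) = \<iota> x" if "m \<in> N" for m
    proof -
      have "?h m = \<one>\<^bsub>G\<^esub>" "m \<in> carrier free_grp"
        using that N_kernel by (auto simp: kernel_def)
      then show ?thesis
        using h.hom_mult[OF _ pos_in_F, of m "[x]"] h_pos[of "[x]"] x by (simp add: pos_value_def)
    qed
    moreover have "N \<noteq> {}" using N.one_closed by blast
    ultimately have "?h ` (N #>\<^bsub>free_grp\<^esub> pos_class [x]) = {\<iota> x}"
      by (auto simp: r_coset_def image_iff)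
    then show ?thesis by simp
  qed
  then have "has_pos_presentation G \<iota> R"
    using iso unfolding has_pos_presentation_def Let_def N_def by (intro bexI) simp_all
  moreover have "\<exists>w. x # w \<in> R" for x
    using inverses unfolding R_def by blast
  ultimately show ?thesis unfolding fully_positive_def by blast
qed

section \<open>Cycles of tiles\<close>

text \<open>A tile is recorded by its west side \<open>q\<close> and its south side \<open>a\<close>. The next tile has west side
  \<open>q \<cdot> a\<close> and north side \<open>a\<close>; invertibility provides the south side.\<close>

definition next_tile :: "('q, 'a) mealy \<Rightarrow> 'q \<times> 'a \<Rightarrow> 'q \<times> 'a" where
  "next_tile M = (\<lambda>(q, a). (trans_fun M q a, inv_into UNIV (prod_fun M (trans_fun M q a)) a))"

lemma next_tile_eq_iff:
  assumes "invertible_mealy M"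
  shows "next_tile M (q, a) = (q', a') \<longleftrightarrow> trans_fun M q a = q' \<and> prod_fun M q' a' = a"
proof -
  have "bij (prod_fun M p)" for p using assms by (simp add: invertible_mealy_def)
  then show ?thesis
    by (auto simp: next_tile_def bij_is_surj surj_f_inv_f intro: inv_f_eq[OF bij_is_inj])
qed

lemma inj_next_tile:
  assumes "invertible_mealy M" "reversible_mealy M"
  shows "inj (next_tile M)"
proof (rule injI)
  fix s t assume eq: "next_tile M s = next_tile M t"
  obtain q a p b where st: "s = (q, a)" "t = (p, b)" by force
  obtain q' a' where n: "next_tile M s = (q', a')" by force
  have s: "trans_fun M q a = q'" "prod_fun M q' a' = a"
    using n next_tile_eq_iff[OF assms(1), of q a] by (simp_all add: st)
  have t: "trans_fun M p b = q'" "prod_fun M q' a' = b"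
    using n next_tile_eq_iff[OF assms(1), of p b] unfolding eq by (simp_all add: st)
  have "inj (\<lambda>q. trans_fun M q a)"
    using assms(2) by (simp add: reversible_mealy_def bij_is_inj)
  then show "s = t" using s t st by (auto dest: injD)
qed

text \<open>A state that reads its own letter writes the preceding one and passes control to the next state,
  so a single state shifts the whole sequence of letters by one place.\<close>

lemma act_shifts_chain:
  assumes trans: "\<And>j. trans_fun M (q j) (a j) = q (Suc j)"
    and prod: "\<And>j. prod_fun M (q (Suc j)) (a (Suc j)) = a j"
  shows "act M (q (Suc j)) (prefix n (suffix (Suc j) a)) = prefix n (suffix j a)"
proof (induction n arbitrary: j)
  case 0
  show ?case by simp
next
  case (Suc n)
  have split: "prefix (Suc n) (suffix i a) = a i # prefix n (suffix (Suc i) a)" for i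
    by (simp add: subsequence_def suffix_def map_upt_Suc del: upt_Suc)
  show ?case
    by (simp only: split act.simps prod trans Suc.IH)
qed

section \<open>The group of an automaton\<close>

lemma state_product_eq: "state_product M = pos_value (mealy_group M) (act M)"
  by (simp add: state_product_def pos_value_def fun_eq_iff)

lemma range_act_subset:
  "invertible_mealy M \<Longrightarrow> range (act M) \<subseteq> carrier (mealy_group M)"
  using act_in_mealy_group by auto

lemma mealy_group_generated:
  fixes M :: "('q, 'a) mealy"
  shows "carrier (mealy_group M) \<subseteq> generate (mealy_group M) (range (act M))"
proof -
  interpret B: group "BijGroup (UNIV :: 'a list set)" by (rule group_BijGroup)
  have "carrier (mealy_group M) = carrier (subgroup_generated (mealy_group M) (range (act M)))"
    by (simp add: mealy_group_def)
  also have "\<dots> \<subseteq> generate (mealy_group M) (range (act M))"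
    unfolding carrier_subgroup_generated by (rule group.mono_generate[OF group_mealy_group]) simp
  finally show ?thesis .
qed

lemma state_product_closed:
  assumes "invertible_mealy M"
  shows "state_product M qs \<in> carrier (mealy_group M)"
  unfolding state_product_eq
  by (rule group.pos_value_closed[OF group_mealy_group range_act_subset[OF assms]])

lemma mealy_group_subset_BijGroup: "carrier (mealy_group M) \<subseteq> carrier (BijGroup UNIV)"
  unfolding mealy_group_def
  by (rule group.carrier_subgroup_generated_subset[OF group_BijGroup])

lemma state_product_apply:
  assumes "invertible_mealy M"
  shows "state_product M qs w = foldr (act M) qs w"
proof (induction qs)
  case Nil
  show ?case by (simp add: state_product_def mealy_group_def BijGroup_def)
next
  case (Cons q qs)
  have "state_product M (q # qs) = act M q \<otimes>\<^bsub>mealy_group M\<^esub> state_product M qs"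
    by (simp add: state_product_def)
  also have "\<dots> = act M q \<circ> state_product M qs"
    using act_in_Bij[OF assms, of q] state_product_closed[OF assms, of qs]
      mealy_group_subset_BijGroup[of M]
    by (auto simp: mealy_group_def intro!: BijGroup_UNIV_mult)
  finally show ?case using Cons by simp
qed

text \<open>The cycle through a tile with state \<open>q\<close>, read as a product of states, moves the periodic word of
  its letters by a full period.\<close>

theorem positive_stabilizer_beginning_with_state:
  fixes M :: "('q::finite, 'a::finite) mealy"
  assumes inv: "invertible_mealy M" and rev: "reversible_mealy M"
  obtains qs \<xi> where "state_product M (q # qs) \<in> pos_stab M \<xi>"
proof -
  let ?f = "next_tile M"
  have inj: "inj ?f" using inv rev by (rule inj_next_tile)
  \<comment> \<open>Every tile lies on a cycle, so any letter can accompany \<open>q\<close>. Starting the chain one tile before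
    \<open>q\<close> gives \<open>q\<close> the index \<open>1\<close>; its output then has index \<open>0\<close>, the start of the word to be fixed.\<close>
  obtain s where s: "?f s = (q, undefined)"
    using finite_UNIV_inj_surj[OF _ inj] by (metis finite_class.finite_UNIV surjD)
  obtain k where k: "k > 0" "(?f ^^ k) s = s"
    using funpow_inj_finite[OF inj, of s] by auto
  define p a where "p j = fst ((?f ^^ j) s)" and "a j = snd ((?f ^^ j) s)" for j
  have "?f (p j, a j) = (p (Suc j), a (Suc j))" for j by (simp add: p_def a_def)
  then have chain: "trans_fun M (p j) (a j) = p (Suc j)"
      "prod_fun M (p (Suc j)) (a (Suc j)) = a j" for j
    using next_tile_eq_iff[OF inv] by blast+
  define qs where "qs = map (\<lambda>i. p (Suc i)) [1..<k]"
  have "map (\<lambda>i. p (Suc i)) [0..<k] = q # qs"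
    using k s by (simp add: qs_def upt_conv_Cons p_def del: upt_Suc)
  moreover have
    "foldr (act M) (map (\<lambda>i. p (Suc i)) [0..<m]) (prefix n (suffix m a)) = prefix n a" for m n
  proof (induction m)
    case 0
    show ?case by simp
  next
    case (Suc m)
    have "act M (p (Suc m)) (prefix n (suffix (Suc m) a)) = prefix n (suffix m a)"
      by (rule act_shifts_chain[of M p a, OF chain])
    moreover have "map (\<lambda>i. p (Suc i)) [0..<Suc m] = map (\<lambda>i. p (Suc i)) [0..<m] @ [p (Suc m)]"
      by simp
    ultimately show ?case
      using Suc by (simp only: foldr_append foldr.simps comp_def id_apply)
  qed
  moreover have "suffix k a = a"
    using k by (simp add: fun_eq_iff a_def funpow_add add.commute[of k])
  ultimately have fixes_prefixes: "state_product M (q # qs) (prefix n a) = prefix n a" for n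
    by (metis state_product_apply[OF inv])
  have "boundary_act (state_product M (q # qs)) a = a"
    unfolding boundary_act_def fixes_prefixes by (simp del: subseq_to_Suc)
  then show ?thesis
    using that state_product_closed[OF inv] unfolding pos_stab_def by blast
qed

theorem theorem5p5:
  fixes M :: "('q::finite, 'a::finite) mealy"
  assumes "invertible_mealy M"
    and "reversible_mealy M"
    and "\<forall>\<xi> :: 'a word. \<forall>g \<in> pos_stab M \<xi>. torsion_element (mealy_group M) g"
  shows "fully_positive (mealy_group M) (act M)"
proof (rule fully_positive_if_positive_inverses)
  show "group (mealy_group M)" by (rule group_mealy_group)
  show "range (act M) \<subseteq> carrier (mealy_group M)" by (rule range_act_subset[OF assms(1)])
  show "carrier (mealy_group M) \<subseteq> generate (mealy_group M) (range (act M))"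
    by (rule mealy_group_generated)
  fix q
  obtain qs and \<xi> :: "'a word" where "state_product M (q # qs) \<in> pos_stab M \<xi>"
    using positive_stabilizer_beginning_with_state[OF assms(1,2)] .
  then obtain n :: nat where n: "n > 0"
      "state_product M (q # qs) [^]\<^bsub>mealy_group M\<^esub> n = \<one>\<^bsub>mealy_group M\<^esub>"
    using assms(3) unfolding torsion_element_def by blast
  then have "pos_value (mealy_group M) (act M) (concat (replicate n (q # qs))) = \<one>\<^bsub>mealy_group M\<^esub>"
    using group.pos_value_power[OF group_mealy_group range_act_subset[OF assms(1)]]
    by (simp add: state_product_eq)
  moreover obtain ws where "concat (replicate n (q # qs)) = q # ws"
    using n(1) by (cases n) auto
  ultimately show "\<exists>w. pos_value (mealy_group M) (act M) (q # w) = \<one>\<^bsub>mealy_group M\<^esub>"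
    by metis
qed

end
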